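(* If $F\in\mathscr{H}$ is the product attractor of $T_0$ (the unique fixed point of $T_0$ in $\mathscr{H}$) and $F_k\in\mathscr{H}(X_k)$ is the attractor of $W_k$ (the unique fixed point of $W_k$ in $\mathscr{H}(X_k)$) for $k=1,2,\dots,m$, then $F=\prod_{k=1}^m F_k$.
   Context: Let $(X_k,d_k)$, $k=1,\dots,m$, be complete metric spaces, $X=\prod_{k=1}^m X_k$ with product metric $d_0(\vec{x},\vec{y})=\left(\sum_{k=1}^m d_k(x_k,y_k)^2\right)^{1/2}$. $\mathscr{H}(Y)$ denotes the set of nonempty compact subsets of $Y$, and $\mathscr{H}=\{A_1\times\cdots\times A_m: A_k\in\mathscr{H}(X_k)\}\subseteq\mathscr{H}(X)$. For each $k$, let $\{(X_k;w_{ki_k}): i_k=1,\dots,N_k\}$ be an iterated function system (IFS), i.e. a finite family of contractions $w_{ki_k}:X_k\to X_k$ with contractivity factors $0\le c_{ki_k}<1$. The product IFS on $X$ consists of the maps $T_{i_1i_2\ldots i_m}(\vec{x})=(w_{1i_1}(x_1),\dots,w_{mi_m}(x_m))$, $1\le i_k\le N_k$, $k=1,\dots,m$. The Hutchinson operators are $W_k:\mathscr{H}(X_k)\to\mathscr{H}(X_k)$, $W_k(B)=\bigcup_{i_k=1}^{N_k}w_{ki_k}(B)$, and $T:\mathscr{H}(X)\to\mathscr{H}(X)$, $T(B)=\bigcup_{i_1=1}^{N_1}\cdots\bigcup_{i_m=1}^{N_m}T_{i_1\ldots i_m}(B)$. $T_0$ denotes the restriction of $T$ to $\mathscr{H}$;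 it maps $\mathscr{H}$ into itself. *)

theory Defs
  imports "HOL-Analysis.Analysis"
begin

definition compacts :: "'a metric \<Rightarrow> 'a set set" where
  "compacts Y = {A. A \<noteq> {} \<and> compactin (mtopology_of Y) A}"

text \<open>Points of the product of \<open>X 1, \<dots>, X m\<close> are extensional functions on \<open>{1..m}\<close>.\<close>

definition product_metric :: "nat \<Rightarrow> (nat \<Rightarrow> 'a metric) \<Rightarrow> (nat \<Rightarrow> 'a) metric" where
  "product_metric m X =
     metric (\<Pi>\<^sub>E k\<in>{1..m}. mspace (X k),
             \<lambda>x y. sqrt (\<Sum>k=1..m. (mdist (X k) (x k) (y k))\<^sup>2))"

definition boxes :: "nat \<Rightarrow> (nat \<Rightarrow> 'a metric) \<Rightarrow> (nat \<Rightarrow> 'a) set set" where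
  "boxes m X = {(\<Pi>\<^sub>E k\<in>{1..m}. A k) | A. \<forall>k\<in>{1..m}. A k \<in> compacts (X k)}"

definition contraction :: "'a metric \<Rightarrow> real \<Rightarrow> ('a \<Rightarrow> 'a) \<Rightarrow> bool" where
  "contraction Y c f \<longleftrightarrow>
     0 \<le> c \<and> c < 1 \<and> f \<in> mspace Y \<rightarrow> mspace Y \<and>
     (\<forall>x\<in>mspace Y. \<forall>y\<in>mspace Y. mdist Y (f x) (f y) \<le> c * mdist Y x y)"

text \<open>The family is required to be nonempty, since otherwise the Hutchinson operator
  would not take values in the nonempty compact sets.\<close>

definition is_IFS :: "'a metric \<Rightarrow> nat \<Rightarrow> (nat \<Rightarrow> real) \<Rightarrow> (nat \<Rightarrow> 'a \<Rightarrow> 'a) \<Rightarrow> bool" where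
  "is_IFS Y N c w \<longleftrightarrow> 1 \<le> N \<and> (\<forall>i\<in>{1..N}. contraction Y (c i) (w i))"

definition hutchinson :: "'a metric \<Rightarrow> 'i set \<Rightarrow> ('i \<Rightarrow> 'a \<Rightarrow> 'a) \<Rightarrow> 'a set \<Rightarrow> 'a set" where
  "hutchinson Y I f = (\<lambda>B\<in>compacts Y. \<Union>i\<in>I. f i ` B)"

text \<open>The multi-index \<open>(i\<^sub>1, \<dots>, i\<^sub>m)\<close> is a function \<open>i\<close> in \<open>multi_indices m N\<close>, and
  \<open>product_map m w i\<close> is the map written \<open>T\<close> with indices \<open>i\<^sub>1 \<dots> i\<^sub>m\<close>.\<close>

definition multi_indices :: "nat \<Rightarrow> (nat \<Rightarrow> nat) \<Rightarrow> (nat \<Rightarrow> nat) set" where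
  "multi_indices m N = (\<Pi>\<^sub>E k\<in>{1..m}. {1..N k})"

definition product_map ::
    "nat \<Rightarrow> (nat \<Rightarrow> nat \<Rightarrow> 'a \<Rightarrow> 'a) \<Rightarrow> (nat \<Rightarrow> nat) \<Rightarrow> (nat \<Rightarrow> 'a) \<Rightarrow> (nat \<Rightarrow> 'a)" where
  "product_map m w i x = (\<lambda>k\<in>{1..m}. w k (i k) (x k))"

definition product_hutchinson ::
    "nat \<Rightarrow> (nat \<Rightarrow> 'a metric) \<Rightarrow> (nat \<Rightarrow> nat) \<Rightarrow> (nat \<Rightarrow> nat \<Rightarrow> 'a \<Rightarrow> 'a) \<Rightarrow>
     (nat \<Rightarrow> 'a) set \<Rightarrow> (nat \<Rightarrow> 'a) set" where
  "product_hutchinson m X N w =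
     hutchinson (product_metric m X) (multi_indices m N) (product_map m w)"

definition product_hutchinson_boxes ::
    "nat \<Rightarrow> (nat \<Rightarrow> 'a metric) \<Rightarrow> (nat \<Rightarrow> nat) \<Rightarrow> (nat \<Rightarrow> nat \<Rightarrow> 'a \<Rightarrow> 'a) \<Rightarrow>
     (nat \<Rightarrow> 'a) set \<Rightarrow> (nat \<Rightarrow> 'a) set" where
  "product_hutchinson_boxes m X N w = restrict (product_hutchinson m X N w) (boxes m X)"

definition is_attractor :: "('s \<Rightarrow> 's) \<Rightarrow> 's set \<Rightarrow> 's \<Rightarrow> bool" where
  "is_attractor S K A \<longleftrightarrow> A \<in> K \<and> S A = A \<and> (\<forall>B\<in>K. S B = B \<longrightarrow> B = A)"

text \<open>\<^const>\<open>metric\<close> is only meaningful on arguments satisfying the metric axioms.\<close>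

lemma Metric_space_product:
  fixes m :: nat and X :: "nat \<Rightarrow> 'a metric"
  shows "Metric_space (\<Pi>\<^sub>E k\<in>{1..m}. mspace (X k))
     (\<lambda>x y. sqrt (\<Sum>k=1..m. (mdist (X k) (x k) (y k))\<^sup>2))"
proof
  fix x y z :: "nat \<Rightarrow> 'a"
  show "0 \<le> sqrt (\<Sum>k=1..m. (mdist (X k) (x k) (y k))\<^sup>2)"
    by (simp add: sum_nonneg)
  show "sqrt (\<Sum>k=1..m. (mdist (X k) (x k) (y k))\<^sup>2)
      = sqrt (\<Sum>k=1..m. (mdist (X k) (y k) (x k))\<^sup>2)"
    by (simp add: mdist_commute)
  assume x: "x \<in> (\<Pi>\<^sub>E k\<in>{1..m}. mspace (X k))" and y: "y \<in> (\<Pi>\<^sub>E k\<in>{1..m}. mspace (X k))"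
  have "sqrt (\<Sum>k=1..m. (mdist (X k) (x k) (y k))\<^sup>2) = 0
      \<longleftrightarrow> (\<forall>k\<in>{1..m}. mdist (X k) (x k) (y k) = 0)"
    by (simp add: sum_nonneg_eq_0_iff)
  also have "\<dots> \<longleftrightarrow> (\<forall>k\<in>{1..m}. x k = y k)"
    using x y by (intro ball_cong refl mdist_zero) (auto dest: PiE_mem)
  also have "\<dots> \<longleftrightarrow> x = y"
    using x y by (auto intro: PiE_ext)
  finally show "sqrt (\<Sum>k=1..m. (mdist (X k) (x k) (y k))\<^sup>2) = 0 \<longleftrightarrow> x = y" .
  assume z: "z \<in> (\<Pi>\<^sub>E k\<in>{1..m}. mspace (X k))"
  have "L2_set (\<lambda>k. mdist (X k) (x k) (z k)) {1..m}
      \<le> L2_set (\<lambda>k. mdist (X k) (x k) (y k) + mdist (X k) (y k) (z k)) {1..m}"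
    using x y z by (intro L2_set_mono mdist_triangle) (auto dest: PiE_mem)
  also have "\<dots> \<le> L2_set (\<lambda>k. mdist (X k) (x k) (y k)) {1..m}
      + L2_set (\<lambda>k. mdist (X k) (y k) (z k)) {1..m}"
    by (rule L2_set_triangle_ineq)
  finally show "sqrt (\<Sum>k=1..m. (mdist (X k) (x k) (z k))\<^sup>2)
      \<le> sqrt (\<Sum>k=1..m. (mdist (X k) (x k) (y k))\<^sup>2)
      + sqrt (\<Sum>k=1..m. (mdist (X k) (y k) (z k))\<^sup>2)"
    by (simp add: L2_set_def)
qed

lemma mspace_product_metric:
  "mspace (product_metric m X) = (\<Pi>\<^sub>E k\<in>{1..m}. mspace (X k))"
  unfolding product_metric_def by (rule Metric_space.mspace_metric[OF Metric_space_product])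

lemma mdist_product_metric:
  "mdist (product_metric m X) = (\<lambda>x y. sqrt (\<Sum>k=1..m. (mdist (X k) (x k) (y k))\<^sup>2))"
  unfolding product_metric_def by (rule Metric_space.mdist_metric[OF Metric_space_product])

lemma boxes_subset_compacts: "boxes m X \<subseteq> compacts (product_metric m X)"
proof
  fix B assume "B \<in> boxes m X"
  then obtain A where B: "B = (\<Pi>\<^sub>E k\<in>{1..m}. A k)"
    and A: "\<And>k. k \<in> {1..m} \<Longrightarrow> A k \<noteq> {} \<and> compactin (mtopology_of (X k)) (A k)"
    by (auto simp: boxes_def compacts_def)
  let ?T = "product_topology (\<lambda>k. mtopology_of (X k)) {1..m}"
  let ?P = "\<Pi>\<^sub>E k\<in>{1..m}. mspace (X k)"
  let ?d = "\<lambda>x y. sqrt (\<Sum>k=1..m. (mdist (X k) (x k) (y k))\<^sup>2)"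
  interpret P: Metric_space ?P ?d by (rule Metric_space_product)
  have "continuous_map ?T P.mtopology id"
    unfolding P.continuous_map_to_metric
  proof (intro ballI allI impI)
    fix x and e :: real assume x: "x \<in> topspace ?T" and e: "0 < e"
    define r where "r = e / (real m + 1)"
    have r: "r > 0" and mr: "real m * r < e"
      using e by (auto simp: r_def field_simps)
    let ?U = "\<Pi>\<^sub>E k\<in>{1..m}. mball_of (X k) (x k) r"
    have xP: "x \<in> ?P" using x by simp
    have "openin ?T ?U"
      by (auto simp: openin_PiE mtopology_of_def mball_of_def Metric_space.openin_mball)
    moreover have "x \<in> ?U"
    proof (rule PiE_I)
      fix k assume "k \<in> {1..m}"
      then have "x k \<in> mspace (X k)" using xP by (rule PiE_mem[rotated])
      then have "mdist (X k) (x k) (x k) = 0" by simp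
      then have "mdist (X k) (x k) (x k) < r" using r by linarith
      with \<open>x k \<in> mspace (X k)\<close> show "x k \<in> mball_of (X k) (x k) r" by simp
    qed (use xP in \<open>auto simp: PiE_iff extensional_def\<close>)
    moreover have "id y \<in> P.mball (id x) e" if y: "y \<in> ?U" for y
    proof -
      have "y \<in> ?P" using y by (auto simp: PiE_iff)
      moreover have "?d x y \<le> (\<Sum>k=1..m. mdist (X k) (x k) (y k))"
        using L2_set_le_sum[of "{1..m}" "\<lambda>k. mdist (X k) (x k) (y k)"]
        by (simp add: L2_set_def)
      moreover have "\<dots> \<le> (\<Sum>k=1..m. r)"
        using y by (intro sum_mono) (auto simp: PiE_iff less_imp_le)
      ultimately show ?thesis
        unfolding P.in_mball id_apply using xP mr by simp
    qed
    ultimately show "\<exists>U. openin ?T U \<and> x \<in> U \<and> (\<forall>y\<in>U. id y \<in> P.mball (id x) e)" by blast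
  qed
  moreover have "compactin ?T B"
    unfolding B using A by (simp add: compactin_PiE)
  ultimately have "compactin P.mtopology (id ` B)"
    by (rule image_compactin[rotated])
  moreover have "mtopology_of (product_metric m X) = P.mtopology"
    by (simp add: mtopology_of_def mspace_product_metric mdist_product_metric)
  moreover have "B \<noteq> {}" using A by (simp add: B PiE_eq_empty_iff)
  ultimately show "B \<in> compacts (product_metric m X)"
    by (simp add: compacts_def)
qed

end

theory Submission
  imports Defs
begin

text \<open>
  A choice of a multi-index \<open>(i\<^sub>1, \<dots>, i\<^sub>m)\<close> is an independent choice of one index per coordinate, so
  the product operator acts on boxes coordinatewise:
  \<open>T (A\<^sub>1 \<times> \<dots> \<times> A\<^sub>m) = W\<^sub>1 A\<^sub>1 \<times> \<dots> \<times> W\<^sub>m A\<^sub>m\<close> (lemma \<open>product_hutchinson_box\<close>).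
  Hence the product of fixed points of the \<open>W\<^sub>k\<close> is a fixed point of \<open>T\<^sub>0\<close> among the boxes, and
  the uniqueness of the attractor of \<open>T\<^sub>0\<close> identifies it with \<open>F\<close>.
\<close>

text \<open>The substantial inclusion is from right to left: if each coordinate \<open>y k\<close> of a point lies in
  some \<open>w k i ` A k\<close>, then picking such an index and a preimage for every \<open>k\<close> separately produces
  one multi-index and one point of the box that is mapped to \<open>y\<close>.\<close>

lemma union_product_map_image_box:
  "(\<Union>i\<in>multi_indices m N. product_map m w i ` (\<Pi>\<^sub>E k\<in>{1..m}. A k))
     = (\<Pi>\<^sub>E k\<in>{1..m}. \<Union>j\<in>{1..N k}. w k j ` A k)" (is "?L = ?R")
proof
  show "?L \<subseteq> ?R"
    by (auto simp: multi_indices_def product_map_def PiE_iff)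
next
  show "?R \<subseteq> ?L"
  proof
    fix y assume y: "y \<in> ?R"
    have "\<forall>k\<in>{1..m}. \<exists>j a. j \<in> {1..N k} \<and> a \<in> A k \<and> y k = w k j a"
      using PiE_mem[OF y] by blast
    then obtain i x
      where ix: "\<And>k. k \<in> {1..m} \<Longrightarrow> i k \<in> {1..N k} \<and> x k \<in> A k \<and> y k = w k (i k) (x k)"
      by metis
    let ?i = "restrict i {1..m}" and ?x = "restrict x {1..m}"
    have "?i \<in> multi_indices m N"
      using ix unfolding multi_indices_def by (intro restrict_PiE_iff[THEN iffD2]) blast
    moreover have "?x \<in> (\<Pi>\<^sub>E k\<in>{1..m}. A k)"
      using ix by (intro restrict_PiE_iff[THEN iffD2]) blast
    moreover have "y = product_map m w ?i ?x"
      by (rule extensionalityI[where A = "{1..m}"])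
        (use y ix in \<open>auto simp: product_map_def PiE_iff\<close>)
    ultimately show "y \<in> ?L" by blast
  qed
qed

text \<open>Both operators are undefined off the compact sets; a box with compact sides is compact, so
  the formula above computes \<open>T\<close> on it.\<close>

lemma product_hutchinson_box:
  assumes "\<And>k. k \<in> {1..m} \<Longrightarrow> A k \<in> compacts (X k)"
  shows "product_hutchinson m X N w (\<Pi>\<^sub>E k\<in>{1..m}. A k)
    = (\<Pi>\<^sub>E k\<in>{1..m}. hutchinson (X k) {1..N k} (w k) (A k))"
proof -
  have "(\<Pi>\<^sub>E k\<in>{1..m}. A k) \<in> boxes m X"
    using assms unfolding boxes_def by blast
  then have "(\<Pi>\<^sub>E k\<in>{1..m}. A k) \<in> compacts (product_metric m X)"
    using boxes_subset_compacts by blast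
  then have "product_hutchinson m X N w (\<Pi>\<^sub>E k\<in>{1..m}. A k)
      = (\<Pi>\<^sub>E k\<in>{1..m}. \<Union>j\<in>{1..N k}. w k j ` A k)"
    unfolding product_hutchinson_def hutchinson_def
    by (simp only: restrict_apply' union_product_map_image_box)
  also have "\<dots> = (\<Pi>\<^sub>E k\<in>{1..m}. hutchinson (X k) {1..N k} (w k) (A k))"
    using assms by (intro PiE_cong) (simp add: hutchinson_def)
  finally show ?thesis .
qed

theorem theorem3p4:
  fixes m :: nat
    and X :: "nat \<Rightarrow> 'a metric"
    and N :: "nat \<Rightarrow> nat"
    and c :: "nat \<Rightarrow> nat \<Rightarrow> real"
    and w :: "nat \<Rightarrow> nat \<Rightarrow> 'a \<Rightarrow> 'a"
    and F :: "(nat \<Rightarrow> 'a) set"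
    and Fs :: "nat \<Rightarrow> 'a set"
  assumes "1 \<le> m"
    and "\<And>k. k \<in> {1..m} \<Longrightarrow> mcomplete_of (X k)"
    and "\<And>k. k \<in> {1..m} \<Longrightarrow> is_IFS (X k) (N k) (c k) (w k)"
    and "is_attractor (product_hutchinson_boxes m X N w) (boxes m X) F"
    and "\<And>k. k \<in> {1..m} \<Longrightarrow>
           is_attractor (hutchinson (X k) {1..N k} (w k)) (compacts (X k)) (Fs k)"
  shows "F = (\<Pi>\<^sub>E k\<in>{1..m}. Fs k)"
proof -
  let ?P = "\<Pi>\<^sub>E k\<in>{1..m}. Fs k"
  have compact: "Fs k \<in> compacts (X k)"
    and fixed: "hutchinson (X k) {1..N k} (w k) (Fs k) = Fs k" if "k \<in> {1..m}" for k
    using assms(5)[OF that] unfolding is_attractor_def by auto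
  have box: "?P \<in> boxes m X"
    using compact unfolding boxes_def by blast
  have "product_hutchinson m X N w ?P
      = (\<Pi>\<^sub>E k\<in>{1..m}. hutchinson (X k) {1..N k} (w k) (Fs k))"
    using compact by (rule product_hutchinson_box)
  also have "\<dots> = ?P"
    using fixed by (rule PiE_cong)
  finally have "product_hutchinson_boxes m X N w ?P = ?P"
    using box unfolding product_hutchinson_boxes_def by simp
  then show ?thesis
    using assms(4) box unfolding is_attractor_def by metis
qed

end
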